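(* Let $q\in(0,1)$ and let $f(x;q)=\sum_{n\ge 0}\frac{x^n}{n!}q^{n(n-1)/2}$. Let $x_1(q)>x_2(q)>x_3(q)>\cdots$ denote the zeros of $x\mapsto f(x;q)$, so that $\cdots<x_{k+1}(q)<x_k(q)<\cdots<x_1(q)<0$. Then for every $k\ge 1$ and $q\in(0,1)$: \begin{align*} &\frac{\mathrm{d} x_k}{\mathrm{d} q}=\frac{x_k^2}{2}\sum_{j\ge 1}\frac{1}{x_j-qx_k},\\ &\sum_{j\ge 1}\frac{1}{x_k-qx_j}=0,\\ &(q-1)\,x_k=\prod_{\substack{j\ge 1\\ j\ne k}}\frac{x_j-x_k}{x_j-qx_k}, \end{align*} where $x_j=x_j(q)$.
   Context: For $q\in(0,1)$ the entire function $f(x;q)=\sum_{n\ge0}x^nq^{n(n-1)/2}/n!$ (the deformed exponential function) has infinitely many zeros, all of them simple and negative, and it admits the product representation $f(x;q)=\prod_{k\ge1}(1-x/x_k(q))$. Since the zeros are simple, each $x_k(q)$ is a differentiable (indeed analytic) function of $q\in(0,1)$. *)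

theory Defs
  imports "HOL-Analysis.Analysis"
begin

definition defexp :: "real \<Rightarrow> real \<Rightarrow> real" where
  "defexp q x = (\<Sum>n. x ^ n * q ^ (n * (n - 1) div 2) / fact n)"

end

theory Submission
  imports Defs "HOL-Complex_Analysis.Great_Picard" "HOL-Real_Asymp.Real_Asymp"
begin

text \<open>
  Write \<open>f\<close> for \<open>defexp q\<close>. Everything follows from \<open>f'(x) = f(q x)\<close>, from
  \<open>df/dq (x) = x^2/2 * f(q^2 x)\<close> and from the product \<open>f(x) = (\<Prod>j. 1 - x / x\<^sub>j)\<close>: the logarithmic
  derivative of the product at \<open>q x\<^sub>k\<close> and at \<open>x\<^sub>k / q\<close> gives the two sums, and comparing
  \<open>f'(x\<^sub>k)\<close> with \<open>f(q x\<^sub>k)\<close> gives the product identity.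

  The product representation is obtained without complex analysis. The polynomials
  \<open>r\<^sub>N(y) = (\<Sum>n\<le>N. (N choose n) * q^(n(n-1)/2) * y^n)\<close> satisfy
  \<open>r\<^bsub>N+1\<^esub>(y) = r\<^sub>N(y) + y * r\<^sub>N(q y)\<close>; by induction and the intermediate value theorem all their
  zeros are real and negative, and consecutive zeros have ratio greater than \<open>1/q\<close>. Hence the
  reciprocals of the zeros decay geometrically, uniformly in \<open>N\<close>, and a compactness argument carries
  the factorization of \<open>r\<^sub>N(x/N)\<close> over to its limit \<open>f(x)\<close>. The same compactness argument, applied
  along a sequence of parameters, shows that each zero depends continuously on \<open>q\<close>.
\<close>

section \<open>Infinite products\<close>

lemma tannery_dominated:
  fixes a :: "nat \<Rightarrow> 'b \<Rightarrow> real"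
  assumes lim: "\<And>k. (a k \<longlongrightarrow> b k) F"
    and bound: "\<forall>\<^sub>F n in F. \<forall>k. \<bar>a k n\<bar> \<le> M k"
    and "summable M" "F \<noteq> bot"
  shows "((\<lambda>n. \<Sum>k. a k n) \<longlongrightarrow> suminf b) F"
proof -
  have "eventually (\<lambda>(k,n). norm (a k n) \<le> M k) (at_top \<times>\<^sub>F F)"
    unfolding eventually_prod_filter using bound
    by (intro exI[of _ "\<lambda>_. True"] exI[of _ "\<lambda>n. \<forall>k. \<bar>a k n\<bar> \<le> M k"]) auto
  from tannerys_theorem[OF lim this assms(3,4)] show ?thesis by blast
qed

lemma prod_one_plus_telescope:
  fixes u :: "nat \<Rightarrow> real"
  shows "(\<Prod>i<n. 1 + u i) = 1 + (\<Sum>k<n. u k * (\<Prod>i<k. 1 + u i))"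
  by (induction n) (auto simp: algebra_simps)

lemma convergent_prod_one_plus:
  fixes u :: "nat \<Rightarrow> real"
  assumes "summable (\<lambda>k. \<bar>u k\<bar>)"
  shows "convergent_prod (\<lambda>k. 1 + u k)"
  by (rule abs_convergent_prod_imp_convergent_prod, rule summable_imp_abs_convergent_prod)
     (use assms in simp)

lemma prodinf_one_plus_eq_suminf:
  fixes u :: "nat \<Rightarrow> real"
  assumes "summable (\<lambda>k. \<bar>u k\<bar>)"
  shows "(\<Prod>k. 1 + u k) = 1 + (\<Sum>k. u k * (\<Prod>i<k. 1 + u i))"
proof -
  have "(\<lambda>n. \<Prod>i<n. 1 + u i) \<longlonglongrightarrow> (\<Prod>k. 1 + u k)"
    by (rule has_prod_imp_tendsto', rule convergent_prod_has_prod,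
        rule convergent_prod_one_plus[OF assms])
  then have "(\<lambda>n. (\<Prod>i<n. 1 + u i) - 1) \<longlonglongrightarrow> (\<Prod>k. 1 + u k) - 1"
    by (intro tendsto_intros)
  moreover have "(\<Prod>i<n. 1 + u i) - 1 = (\<Sum>k<n. u k * (\<Prod>i<k. 1 + u i))" for n
    using prod_one_plus_telescope[of u n] by linarith
  ultimately have "(\<lambda>k. u k * (\<Prod>i<k. 1 + u i)) sums ((\<Prod>k. 1 + u k) - 1)"
    by (simp only: sums_def)
  then show ?thesis by (simp add: sums_iff)
qed

lemma abs_prod_one_plus_le:
  fixes u :: "nat \<Rightarrow> real"
  assumes "\<And>k. \<bar>u k\<bar> \<le> M k" "summable M"
  shows "\<bar>\<Prod>i<n. 1 + u i\<bar> \<le> exp (suminf M)"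
proof -
  have M: "0 \<le> M k" for k using assms(1)[of k] by linarith
  have "\<bar>\<Prod>i<n. 1 + u i\<bar> \<le> (\<Prod>i<n. 1 + M i)"
    unfolding abs_prod
  proof (rule prod_mono)
    fix i show "0 \<le> \<bar>1 + u i\<bar> \<and> \<bar>1 + u i\<bar> \<le> 1 + M i" using assms(1)[of i] by linarith
  qed
  also have "\<dots> \<le> exp (sum M {..<n})" by (rule prod_le_exp_sum) (use M in auto)
  also have "\<dots> \<le> exp (suminf M)" using assms(2) M by (simp add: sum_le_suminf)
  finally show ?thesis .
qed

text \<open>The telescoped form \<open>1 + (\<Sum>k. u k * (\<Prod>i<k. 1 + u i))\<close> of a product reduces limits of
  infinite products to Tannery's theorem for series.\<close>

lemma tendsto_suminf_mult_prod:
  fixes u w :: "nat \<Rightarrow> 'b \<Rightarrow> real"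
  assumes lim: "\<And>k. (u k \<longlongrightarrow> v k) F" and limw: "\<And>k. (w k \<longlongrightarrow> z k) F"
    and bound: "\<forall>\<^sub>F n in F. \<forall>k. \<bar>u k n\<bar> \<le> M k" and boundw: "\<forall>\<^sub>F n in F. \<forall>k. \<bar>w k n\<bar> \<le> M k"
    and M: "summable M" and F: "F \<noteq> bot"
  shows "((\<lambda>n. \<Sum>k. w k n * (\<Prod>i<k. 1 + u i n)) \<longlongrightarrow> (\<Sum>k. z k * (\<Prod>i<k. 1 + v i))) F"
\<comment> \<open>The partial products are at most \<open>exp (suminf M)\<close> in absolute value,
  so \<open>M\<close> times this constant dominates the terms.\<close>
proof (rule tannery_dominated[where M = "\<lambda>k. M k * exp (suminf M)"])
  show "((\<lambda>n. w k n * (\<Prod>i<k. 1 + u i n)) \<longlongrightarrow> z k * (\<Prod>i<k. 1 + v i)) F" for k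
    by (intro tendsto_intros lim limw)
  show "\<forall>\<^sub>F n in F. \<forall>k. \<bar>w k n * (\<Prod>i<k. 1 + u i n)\<bar> \<le> M k * exp (suminf M)"
    using bound boundw
  proof eventually_elim
    case (elim n)
    show ?case
    proof
      fix k
      have "\<bar>\<Prod>i<k. 1 + u i n\<bar> \<le> exp (suminf M)"
        by (rule abs_prod_one_plus_le) (use elim M in auto)
      moreover have "0 \<le> M k" using order_trans[OF abs_ge_zero elim(2)[rule_format]] .
      ultimately show "\<bar>w k n * (\<Prod>i<k. 1 + u i n)\<bar> \<le> M k * exp (suminf M)"
        unfolding abs_mult using elim(2) by (intro mult_mono) auto
    qed
  qed
qed (use M F in \<open>auto intro: summable_mult2\<close>)

lemma tendsto_prodinf_dominated:
  fixes u :: "nat \<Rightarrow> 'b \<Rightarrow> real"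
  assumes lim: "\<And>k. (u k \<longlongrightarrow> v k) F"
    and bound: "\<forall>\<^sub>F n in F. \<forall>k. \<bar>u k n\<bar> \<le> M k"
    and M: "summable M" and F: "F \<noteq> bot"
  shows "((\<lambda>n. \<Prod>k. 1 + u k n) \<longlongrightarrow> (\<Prod>k. 1 + v k)) F"
proof -
  have v: "\<bar>v k\<bar> \<le> M k" for k
  proof (rule tendsto_upperbound[OF tendsto_rabs[OF lim] _ F])
    show "\<forall>\<^sub>F n in F. \<bar>u k n\<bar> \<le> M k" using bound by eventually_elim simp
  qed
  have sv: "summable (\<lambda>k. \<bar>v k\<bar>)"
    by (rule summable_comparison_test[OF _ M]) (use v in auto)
  have "((\<lambda>n. 1 + (\<Sum>k. u k n * (\<Prod>i<k. 1 + u i n))) \<longlongrightarrow> 1 + (\<Sum>k. v k * (\<Prod>i<k. 1 + v i))) F"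
    by (intro tendsto_add tendsto_const tendsto_suminf_mult_prod[OF lim lim bound bound M F])
  also have "1 + (\<Sum>k. v k * (\<Prod>i<k. 1 + v i)) = (\<Prod>k. 1 + v k)"
    using prodinf_one_plus_eq_suminf[OF sv] by simp
  finally show ?thesis
  proof (rule Lim_transform_eventually)
    show "\<forall>\<^sub>F n in F. 1 + (\<Sum>k. u k n * (\<Prod>i<k. 1 + u i n)) = (\<Prod>k. 1 + u k n)"
      using bound
    proof eventually_elim
      case (elim n)
      have "summable (\<lambda>k. \<bar>u k n\<bar>)"
        by (rule summable_comparison_test[OF _ M]) (use elim in auto)
      then show ?case using prodinf_one_plus_eq_suminf by simp
    qed
  qed
qed

section \<open>Logarithmic derivative of an infinite product\<close>

text \<open>With \<open>b j = c j / (1 + c j * y)\<close> each factor satisfies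
  \<open>1 + c j * (y + h) = (1 + c j * y) * (1 + b j * h)\<close>. Hence
  \<open>G (y + h) / G y\<close> is again a product of the same kind, now centred at
  \<open>h = 0\<close>, and its telescoped form exhibits the difference quotient as a series to
  which Tannery's theorem applies.\<close>

lemma log_derivative_prodinf_linear:
  fixes c :: "nat \<Rightarrow> real"
  assumes c: "summable (\<lambda>j. \<bar>c j\<bar>)" and nz: "\<And>j. 1 + c j * y \<noteq> 0"
  shows "summable (\<lambda>j. c j / (1 + c j * y))"
    and "((\<lambda>y. \<Prod>j. 1 + c j * y) has_real_derivative
           (\<Prod>j. 1 + c j * y) * (\<Sum>j. c j / (1 + c j * y))) (at y)"
proof -
  define b where "b j = c j / (1 + c j * y)" for j
  define G where "G y = (\<Prod>j. 1 + c j * y)" for y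
  have "c \<longlonglongrightarrow> 0" using summable_LIMSEQ_zero[OF c] by (simp only: tendsto_rabs_zero_iff)
  then have "(\<lambda>j. 1 + c j * y) \<longlonglongrightarrow> 1" by (auto intro!: tendsto_eq_intros)
  \<comment> \<open>Denominators eventually above 1/2 bound \<open>b j\<close> by
    \<open>2 * \<bar>c j\<bar>\<close>.\<close>
  then have "\<forall>\<^sub>F j in sequentially. 1 + c j * y > 1/2" by (rule order_tendstoD) simp
  then have "\<forall>\<^sub>F j in sequentially. norm \<bar>b j\<bar> \<le> 2 * \<bar>c j\<bar>"
  proof eventually_elim
    case (elim j)
    have "\<bar>c j\<bar> \<le> 2 * \<bar>c j\<bar> * (1 + c j * y)"
      using elim mult_left_mono[of "1/2" "1 + c j * y" "2 * \<bar>c j\<bar>"] by simp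
    then show ?case using elim by (simp add: b_def abs_divide divide_le_eq)
  qed
  then have b: "summable (\<lambda>j. \<bar>b j\<bar>)"
    by (rule summable_comparison_test_ev) (use c in \<open>auto intro: summable_mult\<close>)
  then show "summable (\<lambda>j. c j / (1 + c j * y))"
    unfolding b_def by (rule summable_rabs_cancel)
  have bh: "summable (\<lambda>j. \<bar>b j * h\<bar>)" for h
    unfolding abs_mult by (intro summable_mult2 b)
  have ch: "summable (\<lambda>j. \<bar>c j * y\<bar>)"
    unfolding abs_mult by (intro summable_mult2 c)
  have G: "G (y + h) = G y * (\<Prod>j. 1 + b j * h)" for h
  proof -
    have "G y * (\<Prod>j. 1 + b j * h) = (\<Prod>j. (1 + c j * y) * (1 + b j * h))"
      unfolding G_def by (intro prodinf_mult convergent_prod_one_plus bh ch)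
    also have "\<dots> = G (y + h)"
      unfolding G_def
    proof (rule prodinf_cong)
      fix j show "(1 + c j * y) * (1 + b j * h) = 1 + c j * (y + h)"
        using nz[of j] by (simp add: b_def field_simps)
    qed
    finally show ?thesis by simp
  qed
  have G0: "G y * (\<Sum>k. b k * (\<Prod>i<k. 1 + b i * h)) = (G (y + h) - G y) / h" if "h \<noteq> 0" for h
  proof -
    have "(\<Sum>k. b k * h * (\<Prod>i<k. 1 + b i * h)) = (\<Prod>k. 1 + b k * h) - 1"
      using prodinf_one_plus_eq_suminf[OF bh[of h]] by simp
    moreover have "(\<Sum>k. b k * h * (\<Prod>i<k. 1 + b i * h)) = h * (\<Sum>k. b k * (\<Prod>i<k. 1 + b i * h))"
    proof -
      have "summable (\<lambda>k. b k * (\<Prod>i<k. 1 + b i * h))"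
      proof (rule summable_comparison_test[OF _ summable_mult2[OF b, of "exp (\<Sum>j. \<bar>b j * h\<bar>)"]],
          intro exI allI impI)
        fix n
        have "\<bar>\<Prod>i<n. 1 + b i * h\<bar> \<le> exp (\<Sum>j. \<bar>b j * h\<bar>)"
          by (rule abs_prod_one_plus_le) (use bh in auto)
        then show "norm (b n * (\<Prod>i<n. 1 + b i * h)) \<le> \<bar>b n\<bar> * exp (\<Sum>j. \<bar>b j * h\<bar>)"
          by (auto simp: abs_mult intro!: mult_left_mono)
      qed
      from suminf_mult[OF this, of h] show ?thesis by (simp add: mult_ac)
    qed
    ultimately have "h * (\<Sum>k. b k * (\<Prod>i<k. 1 + b i * h)) = (\<Prod>k. 1 + b k * h) - 1" by simp
    then have "G (y + h) - G y = G y * (h * (\<Sum>k. b k * (\<Prod>i<k. 1 + b i * h)))"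
      by (simp only: G) (simp only: right_diff_distrib mult_1_right)
    then show ?thesis using that by simp
  qed
  \<comment> \<open>The leading factor \<open>b k\<close> is constant in \<open>h\<close> while the
    inner factors use \<open>b i * h\<close>; this is why the limit lemma allows two different
    families. For \<open>\<bar>h\<bar> < 1\<close> both are dominated by
    \<open>\<bar>b k\<bar>\<close>.\<close>
  have "((\<lambda>h. \<Sum>k. b k * (\<Prod>i<k. 1 + b i * h)) \<longlongrightarrow> (\<Sum>k. b k * (\<Prod>i<k. 1 + 0))) (at 0)"
  proof (rule tendsto_suminf_mult_prod[where M = "\<lambda>k. \<bar>b k\<bar>"])
    show "((\<lambda>h. b k * h) \<longlongrightarrow> 0) (at 0)" for k by (auto intro!: tendsto_eq_intros)
    have "\<forall>\<^sub>F h in at (0::real). \<bar>h\<bar> < 1"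
      by (auto simp: eventually_at dist_real_def intro!: exI[of _ 1])
    then show "\<forall>\<^sub>F h in at 0. \<forall>k. \<bar>b k * h\<bar> \<le> \<bar>b k\<bar>"
      by eventually_elim (auto simp: abs_mult mult_left_le)
  qed (use b in auto)
  then have "((\<lambda>h. G y * (\<Sum>k. b k * (\<Prod>i<k. 1 + b i * h))) \<longlongrightarrow> G y * (\<Sum>k. b k)) (at 0)"
    by (intro tendsto_mult tendsto_const) simp
  then have "((\<lambda>h. (G (y + h) - G y) / h) \<longlongrightarrow> G y * (\<Sum>k. b k)) (at 0)"
    by (rule Lim_transform_eventually) (auto simp: eventually_at_filter G0)
  then show "((\<lambda>y. \<Prod>j. 1 + c j * y) has_real_derivative
           (\<Prod>j. 1 + c j * y) * (\<Sum>j. c j / (1 + c j * y))) (at y)"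
    by (simp add: DERIV_def G_def b_def)
qed

section \<open>Compactness for products with geometrically decaying coefficients\<close>

text \<open>The intended \<open>c j\<close> are the numbers \<open>-1 / z j\<close> for negative
  zeros \<open>z j\<close>. The inequalities are weak so that they pass to limits, and zero entries
  are allowed so that a finite product can be padded with factors 1.\<close>

definition geo_decay :: "real \<Rightarrow> (nat \<Rightarrow> real) \<Rightarrow> bool" where
  "geo_decay \<rho> c \<longleftrightarrow> (\<forall>j. 0 \<le> c j \<and> c (Suc j) \<le> \<rho> * c j)"

lemma geo_decay_le:
  assumes "geo_decay \<rho> c" "0 \<le> \<rho>"
  shows "c j \<le> c 0 * \<rho> ^ j"
proof (induction j)
  case (Suc j)
  have "c (Suc j) \<le> \<rho> * c j" using assms by (auto simp: geo_decay_def)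
  also have "\<dots> \<le> \<rho> * (c 0 * \<rho> ^ j)" using Suc assms by (intro mult_left_mono) auto
  finally show ?case by (simp add: mult_ac)
qed auto

lemma geo_decay_summable:
  assumes "geo_decay \<rho> c" "0 \<le> \<rho>" "\<rho> < 1"
  shows "summable (\<lambda>j. \<bar>c j\<bar>)"
proof (rule summable_comparison_test)
  show "\<exists>N. \<forall>n\<ge>N. norm \<bar>c n\<bar> \<le> c 0 * \<rho> ^ n"
    using geo_decay_le[OF assms(1,2)] assms(1) by (auto simp: geo_decay_def)
  show "summable (\<lambda>n. c 0 * \<rho> ^ n)"
    using assms by (intro summable_mult summable_geometric) auto
qed

text \<open>Convergence at the single point \<open>y = 1\<close> bounds the leading coefficients
  \<open>c n 0\<close>, and the decay then gives a summable majorant independent of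
  \<open>n\<close>. A diagonal subsequence makes all coefficients converge, and dominated
  convergence of products identifies the limit function.\<close>

lemma geo_decay_product_limit:
  fixes c :: "nat \<Rightarrow> nat \<Rightarrow> real"
  assumes c: "\<And>n. geo_decay \<rho> (c n)" and \<rho>: "0 \<le> \<rho>" "\<rho> < 1"
    and lim: "\<And>y. (\<lambda>n. \<Prod>j. 1 + c n j * y) \<longlonglongrightarrow> f y"
  obtains r b where "strict_mono (r :: nat \<Rightarrow> nat)" "geo_decay \<rho> b"
    "\<And>j. (\<lambda>n. c (r n) j) \<longlonglongrightarrow> b j" "\<And>y. f y = (\<Prod>j. 1 + b j * y)"
proof -
  have sc: "summable (\<lambda>j. \<bar>c n j * y\<bar>)" for n y
    unfolding abs_mult by (intro summable_mult2 geo_decay_summable[OF c \<rho>])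
  have pos: "0 \<le> c n j" for n j using c by (auto simp: geo_decay_def)
  obtain C where C: "\<And>n. norm (\<Prod>j. 1 + c n j * 1) \<le> C"
    using convergent_imp_Bseq[OF convergentI[OF lim[of 1]]] unfolding Bseq_def by blast
  have C0: "c n 0 \<le> C" for n
  proof -
    \<comment> \<open>At \<open>y = 1\<close> all factors are at least 1, so the product is at least
      its first factor.\<close>
    have "(\<Prod>j<1. 1 + c n j * 1) \<le> (\<Prod>j. 1 + c n j * 1)"
      by (rule prod_le_prodinf[OF convergent_prod_has_prod[OF convergent_prod_one_plus[OF sc]]])
         (use pos in auto)
    then show ?thesis using C[of n] by simp
  qed
  have le: "c n j \<le> C * \<rho> ^ j" for n j
    using geo_decay_le[OF c[of n] \<rho>(1), of j] mult_right_mono[OF C0[of n], of "\<rho> ^ j"] \<rho> by simp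
  have Cpos: "0 \<le> C" using order_trans[OF pos C0] .
  have bnd: "norm (c n j) \<le> C" for n j
  proof -
    have "C * \<rho> ^ j \<le> C" using \<rho> Cpos by (simp add: mult_left_le power_le_one)
    with le[of n j] pos[of n j] show ?thesis by simp
  qed
  obtain r where r: "strict_mono (r :: nat \<Rightarrow> nat)" "\<And>j. \<exists>l. (\<lambda>n. c (r n) j) \<longlonglongrightarrow> l"
    using function_convergent_subsequence[of "UNIV :: nat set" c C] bnd by auto
  then obtain b where b: "\<And>j. (\<lambda>n. c (r n) j) \<longlonglongrightarrow> b j" by metis
  have "geo_decay \<rho> b"
    unfolding geo_decay_def
  proof (intro allI conjI)
    fix j
    show "0 \<le> b j" by (rule LIMSEQ_le_const[OF b]) (use pos in auto)
    show "b (Suc j) \<le> \<rho> * b j"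
      by (rule LIMSEQ_le[OF b tendsto_mult[OF tendsto_const b]]) (use c in \<open>auto simp: geo_decay_def\<close>)
  qed
  moreover have "f y = (\<Prod>j. 1 + b j * y)" for y
  proof (rule LIMSEQ_unique)
    show "(\<lambda>n. \<Prod>j. 1 + c (r n) j * y) \<longlonglongrightarrow> f y"
      using LIMSEQ_subseq_LIMSEQ[OF lim r(1)] by (simp add: o_def)
    show "(\<lambda>n. \<Prod>j. 1 + c (r n) j * y) \<longlonglongrightarrow> (\<Prod>j. 1 + b j * y)"
    proof (rule tendsto_prodinf_dominated[where M = "\<lambda>j. C * \<rho> ^ j * \<bar>y\<bar>"])
      show "(\<lambda>n. c (r n) k * y) \<longlonglongrightarrow> b k * y" for k by (intro tendsto_intros b)
      show "\<forall>\<^sub>F n in sequentially. \<forall>k. \<bar>c (r n) k * y\<bar> \<le> C * \<rho> ^ k * \<bar>y\<bar>"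
        using le pos by (auto simp: abs_mult intro!: mult_right_mono always_eventually)
      show "summable (\<lambda>j. C * \<rho> ^ j * \<bar>y\<bar>)"
        using \<rho> by (intro summable_mult summable_mult2 summable_geometric) auto
    qed auto
  qed
  ultimately show ?thesis using that r(1) b by blast
qed

section \<open>Real-rooted polynomial approximations\<close>

text \<open>Binomial coefficients are preferred to truncating the series: Pascal's rule then yields
  a recursion that preserves real zeros, while substituting \<open>x / N\<close> for
  \<open>y\<close> recovers \<open>1 / fact n\<close> in the limit.\<close>

definition defexp_poly :: "real \<Rightarrow> nat \<Rightarrow> real poly" where
  "defexp_poly q N = (\<Sum>n\<le>N. monom (real (N choose n) * q ^ (n * (n - 1) div 2)) n)"

lemma poly_defexp_poly:
  "poly (defexp_poly q N) y = (\<Sum>n\<le>N. real (N choose n) * q ^ (n * (n - 1) div 2) * y ^ n)"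
  by (simp add: defexp_poly_def poly_sum poly_monom)

lemma degree_defexp_poly: "degree (defexp_poly q N) \<le> N"
  unfolding defexp_poly_def
  by (rule degree_sum_le) (auto intro: order_trans[OF degree_monom_le])

lemma triangle_Suc: "Suc n * (Suc n - 1) div 2 = n * (n - 1) div 2 + n"
proof -
  have "Suc n * (Suc n - 1) = n * (n - 1) + n * 2" by (cases n) auto
  then show ?thesis by simp
qed

lemma poly_defexp_poly_0: "poly (defexp_poly q N) 0 = 1"
  by (simp add: poly_defexp_poly power_0_left if_distrib[of "\<lambda>x. _ * x"] sum.delta cong: if_cong)

text \<open>Pascal's rule splits each coefficient in two. In the shifted half the exponent of
  \<open>q\<close> grows by \<open>n\<close>, which is absorbed by evaluating at
  \<open>q * y\<close>.\<close>

lemma poly_defexp_poly_Suc: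
  "poly (defexp_poly q (Suc N)) y = poly (defexp_poly q N) y + y * poly (defexp_poly q N) (q * y)"
proof -
  let ?e = "\<lambda>n. q ^ (n * (n - 1) div 2)"
  have "poly (defexp_poly q (Suc N)) y
      = 1 + (\<Sum>n\<le>N. real (Suc N choose Suc n) * ?e (Suc n) * y ^ Suc n)"
    unfolding poly_defexp_poly by (subst sum.atMost_Suc_shift) simp
  also have "\<dots> = (1 + (\<Sum>n\<le>N. real (N choose Suc n) * ?e (Suc n) * y ^ Suc n))
      + (\<Sum>n\<le>N. real (N choose n) * ?e (Suc n) * y ^ Suc n)"
    by (simp add: sum.distrib[symmetric] algebra_simps)
  also have "1 + (\<Sum>n\<le>N. real (N choose Suc n) * ?e (Suc n) * y ^ Suc n)
      = (\<Sum>n\<le>Suc N. real (N choose n) * ?e n * y ^ n)"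
    by (subst sum.atMost_Suc_shift) simp
  also have "\<dots> = poly (defexp_poly q N) y" by (simp add: poly_defexp_poly)
  also have "(\<Sum>n\<le>N. real (N choose n) * ?e (Suc n) * y ^ Suc n) = y * poly (defexp_poly q N) (q * y)"
    unfolding poly_defexp_poly sum_distrib_left triangle_Suc
    by (intro sum.cong refl) (simp add: power_add power_mult_distrib mult_ac)
  finally show ?thesis .
qed

text \<open>Both sides have degree at most \<open>n\<close> and agree at \<open>n + 1\<close>
  points, the zeros \<open>z i\<close> and 0.\<close>

lemma poly_eq_prod_roots:
  fixes p :: "real poly"
  assumes "degree p \<le> n" "poly p 0 = 1" and inj: "inj_on z {..<n}"
    and z: "\<And>i. i < n \<Longrightarrow> z i \<noteq> 0" "\<And>i. i < n \<Longrightarrow> poly p (z i) = 0"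
  shows "poly p y = (\<Prod>i<n. 1 - y / z i)"
proof -
  define r where "r = (\<Prod>i<n. [:1, - (1 / z i):])"
  have r: "poly r y = (\<Prod>i<n. 1 - y / z i)" for y
    by (simp add: r_def poly_prod)
  have "degree r \<le> (\<Sum>i<n. degree [:1, - (1 / z i):])"
    unfolding r_def by (rule order_trans[OF degree_prod_sum_le]) auto
  also have "\<dots> \<le> (\<Sum>i<n. 1)" by (intro sum_mono) auto
  finally have "degree r \<le> n" by simp
  have "card (insert 0 (z ` {..<n})) = Suc n"
    using inj z(1) by (subst card_insert_disjoint) (auto simp: card_image)
  moreover have "poly p x = poly r x" if "x \<in> insert 0 (z ` {..<n})" for x
  proof -
    have "poly r (z i) = 0" if "i < n" for i
      unfolding r using that z(1)[OF that] by (intro prod_zero) (auto intro!: bexI[of _ i])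
    with that assms z(2) show ?thesis by (auto simp: r)
  qed
  ultimately have "p = r"
    using \<open>degree r \<le> n\<close> assms(1) by (intro poly_eqI_degree[where A = "insert 0 (z ` {..<n})"]) auto
  then show ?thesis by (simp add: r)
qed

lemma prod_linear_sign:
  fixes c :: "nat \<Rightarrow> real"
  assumes "j \<le> M" "\<And>i. i < j \<Longrightarrow> 1 + c i * y < 0" "\<And>i. j \<le> i \<Longrightarrow> i < M \<Longrightarrow> 0 < 1 + c i * y"
  shows "0 < (-1) ^ j * (\<Prod>i<M. 1 + c i * y)"
proof -
  have "(\<Prod>i<M. 1 + c i * y) = (\<Prod>i<j. 1 + c i * y) * (\<Prod>i=j..<M. 1 + c i * y)"
    using prod.atLeastLessThan_concat[of 0 j M "\<lambda>i. 1 + c i * y"] assms(1)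
    by (simp add: atLeast0LessThan)
  moreover have "(-1) ^ j * (\<Prod>i<j. 1 + c i * y) = (\<Prod>i<j. - (1 + c i * y))"
    unfolding prod_uminus by simp
  moreover have "0 < (\<Prod>i<j. - (1 + c i * y))" using assms(2) by (intro prod_pos) (simp, force)
  moreover have "0 < (\<Prod>i=j..<M. 1 + c i * y)" using assms(3) by (intro prod_pos) auto
  ultimately show ?thesis by (simp add: mult.assoc[symmetric])
qed

text \<open>The \<open>q\<close>-separation of the zeros \<open>-1 / c i\<close> is what survives the recursion
  \<open>r(y) + y * r(q y)\<close>: the new function has sign \<open>(-1)^(i+1)\<close> at both \<open>-1 / c i\<close> and
  \<open>-1 / (q * c i)\<close>, so it has one zero in each gap between these intervals.\<close>

lemma q_separated_zeros_step:
  fixes c :: "nat \<Rightarrow> real"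
  assumes q: "0 < q" "q < 1" and pos: "\<And>i. i < M \<Longrightarrow> 0 < c i"
    and sep: "\<And>i. Suc i < M \<Longrightarrow> c (Suc i) < q * c i"
  defines "R \<equiv> \<lambda>y. (\<Prod>i<M. 1 + c i * y) + y * (\<Prod>i<M. 1 + c i * (q * y))"
  obtains z where "\<And>i. i \<le> M \<Longrightarrow> R (z i) = 0" "\<And>i. i \<le> M \<Longrightarrow> z i < 0"
    "\<And>i. i < M \<Longrightarrow> z (Suc i) < z i / q"
proof -
  have chain: "c i < q * c k" if "k < i" "i < M" for i k
    using that
  proof (induction i)
    case (Suc i)
    show ?case
    proof (cases "k = i")
      case False
      then have "c i < q * c k" using Suc by auto
      moreover have "q * c i < c i" using pos[of i] Suc.prems q by simp
      ultimately show ?thesis using sep[of i] Suc.prems by linarith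
    qed (use sep Suc.prems in auto)
  qed auto
  have decr: "c i < c k" if "k < i" "i < M" for i k
    using chain[OF that] pos[of k] that q mult_strict_right_mono[of q 1 "c k"] by linarith
  \<comment> \<open>At \<open>- 1 / c i\<close> the first product vanishes. In the second, factor
    \<open>k\<close> equals \<open>1 - q * c k / c i\<close>, which by separation is negative
    exactly for \<open>k < i\<close>; the outer factor \<open>y < 0\<close> contributes one more
    sign.\<close>
  have low: "0 < (-1) ^ Suc i * R (- 1 / c i)" if "i < M" for i
  proof -
    have ci: "0 < c i" using pos that by blast
    have "0 < (-1) ^ i * (\<Prod>k<M. 1 + c k * (q * (- 1 / c i)))"
    proof (rule prod_linear_sign)
      show "1 + c k * (q * (- 1 / c i)) < 0" if "k < i" for k
        using chain[OF that \<open>i < M\<close>] ci by (simp add: field_simps)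
      show "0 < 1 + c k * (q * (- 1 / c i))" if "i \<le> k" "k < M" for k
      proof -
        have "c k \<le> c i" using decr[of i k] that by (cases "k = i") auto
        then have "q * c k \<le> q * c i" using q by simp
        also have "\<dots> < c i" using q ci by simp
        finally show ?thesis using ci by (simp add: field_simps)
      qed
    qed (use that in auto)
    moreover have "(\<Prod>k<M. 1 + c k * (- 1 / c i)) = 0"
      using that ci by (intro prod_zero) (auto intro!: bexI[of _ i])
    moreover from this have "(-1) ^ Suc i * R (- 1 / c i)
        = ((-1) ^ i * (\<Prod>k<M. 1 + c k * (q * (- 1 / c i)))) / c i"
      by (simp only: R_def) simp
    ultimately show ?thesis using ci by (metis divide_pos_pos)
  qed
  \<comment> \<open>At \<open>- 1 / (q * c i)\<close> it is the second product that vanishes, and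
    exactly the factors \<open>k \<le> i\<close> of the first are negative.\<close>
  have upp: "0 < (-1) ^ Suc i * R (- 1 / (q * c i))" if "i < M" for i
  proof -
    have ci: "0 < c i" using pos that by blast
    have "0 < (-1) ^ Suc i * (\<Prod>k<M. 1 + c k * (- 1 / (q * c i)))"
    proof (rule prod_linear_sign)
      show "1 + c k * (- 1 / (q * c i)) < 0" if "k < Suc i" for k
      proof -
        have "c i \<le> c k" using decr[of k i] that \<open>i < M\<close> by (cases "k = i") auto
        moreover have "q * c i < c i" using q ci by simp
        ultimately have "q * c i < c k" by linarith
        then show ?thesis using ci q by (simp add: field_simps)
      qed
      show "0 < 1 + c k * (- 1 / (q * c i))" if "Suc i \<le> k" "k < M" for k
        using chain[of i k] that ci q by (simp add: field_simps)
    qed (use that in auto)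
    moreover have "(\<Prod>k<M. 1 + c k * (q * (- 1 / (q * c i)))) = 0"
      using that ci q by (intro prod_zero) (auto intro!: bexI[of _ i])
    ultimately show ?thesis unfolding R_def by (simp only: mult_zero_right add_0_right)
  qed
  \<comment> \<open>The quotient of the two products tends to \<open>(1 / q) ^ M\<close>, so near
    minus infinity the term carrying the extra factor \<open>y\<close> determines the sign of
    \<open>R\<close>.\<close>
  have "\<forall>\<^sub>F y in at_bot. 0 < (-1) ^ Suc M * R y"
  proof -
    have "((\<lambda>y. (\<Prod>i<M. (1 + c i * y) / (1 + c i * (q * y))) / y) \<longlongrightarrow> 0) at_bot"
    proof (rule tendsto_divide_0)
      show "((\<lambda>y. \<Prod>i<M. (1 + c i * y) / (1 + c i * (q * y))) \<longlongrightarrow> (\<Prod>i<M. 1 / q)) at_bot"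
      proof (rule tendsto_prod)
        fix i assume "i \<in> {..<M}"
        then have "0 < c i" using pos by simp
        with q show "((\<lambda>y. (1 + c i * y) / (1 + c i * (q * y))) \<longlongrightarrow> 1 / q) at_bot"
          by (real_asymp simp add: field_simps)
      qed
    qed (rule filterlim_at_bot_imp_at_infinity[OF filterlim_ident])
    then have "\<forall>\<^sub>F y in at_bot. -1 < (\<Prod>i<M. (1 + c i * y) / (1 + c i * (q * y))) / y"
      by (rule order_tendstoD) simp
    moreover have "\<forall>\<^sub>F y in at_bot. \<forall>i\<in>{..<M}. 1 + c i * (q * y) < 0"
    proof (rule eventually_ball_finite)
      show "\<forall>i\<in>{..<M}. \<forall>\<^sub>F y in at_bot. 1 + c i * (q * y) < 0"
      proof
        fix i assume "i \<in> {..<M}"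
        then have "0 < c i" using pos by simp
        with q show "\<forall>\<^sub>F y in at_bot. 1 + c i * (q * y) < 0" by real_asymp
      qed
    qed simp
    moreover have "\<forall>\<^sub>F y in at_bot. y < (0::real)" by real_asymp
    ultimately show ?thesis
    proof eventually_elim
      case (elim y)
      let ?D = "\<Prod>i<M. 1 + c i * (q * y)"
      have D: "0 < (-1) ^ M * ?D" by (rule prod_linear_sign) (use elim in auto)
      then have D0: "?D \<noteq> 0" by (metis mult_zero_right less_irrefl)
      have alg: "a + y * d = (1 + a / d / y) * (y * d)" if "d \<noteq> 0" for a d
        using elim that by (simp add: field_simps)
      have "R y = (1 + (\<Prod>i<M. (1 + c i * y) / (1 + c i * (q * y))) / y) * (y * ?D)"
        unfolding R_def prod_dividef by (rule alg[OF D0])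
      then have "(-1) ^ Suc M * R y
          = (1 + (\<Prod>i<M. (1 + c i * y) / (1 + c i * (q * y))) / y) * (- y) * ((-1) ^ M * ?D)"
        by simp
      also have "0 < \<dots>" using elim by (intro mult_pos_pos[OF mult_pos_pos D]) auto
      finally show ?case .
    qed
  qed
  \<comment> \<open>The gaps are the intervals from \<open>L i\<close> to \<open>U i\<close>. The
    first ends at 0, where \<open>R\<close> is 1; the last begins at a point \<open>Y\<close> far to
    the left, which supplies the additional zero.\<close>
  define U where "U i = (if i = 0 then 0 else - 1 / (q * c (i - 1)))" for i
  have "\<forall>\<^sub>F y in at_bot. y < U M" by real_asymp
  with \<open>\<forall>\<^sub>F y in at_bot. 0 < (-1) ^ Suc M * R y\<close>
  have "\<forall>\<^sub>F y in at_bot. 0 < (-1) ^ Suc M * R y \<and> y < U M" by eventually_elim simp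
  then obtain Y where Y: "0 < (-1) ^ Suc M * R Y" "Y < U M"
    using eventually_happens[of _ "at_bot :: real filter"] by auto
  define L where "L i = (if i < M then - 1 / c i else Y)" for i
  have LU: "L i < U i" if "i \<le> M" for i
  proof (cases "i = M")
    case False
    then have "i < M" using that by simp
    show ?thesis
    proof (cases i)
      case (Suc k)
      then show ?thesis
        using sep[of k] pos[of i] pos[of k] q \<open>i < M\<close> by (simp add: L_def U_def field_simps)
    qed (use pos \<open>i < M\<close> in \<open>auto simp: L_def U_def\<close>)
  qed (use Y in \<open>auto simp: L_def\<close>)
  have signL: "0 < (-1) ^ Suc i * R (L i)" if "i \<le> M" for i
    using low[of i] Y that by (cases "i = M") (auto simp: L_def)
  have signU: "0 < (-1) ^ i * R (U i)" if "i \<le> M" for i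
  proof (cases i)
    case (Suc k)
    then show ?thesis using upp[of k] that by (simp add: U_def)
  qed (simp add: U_def R_def)
  have "\<exists>z. L i < z \<and> z < U i \<and> R z = 0" if i: "i \<le> M" for i
  proof -
    have "continuous_on {L i..U i} (\<lambda>y. (-1) ^ i * R y)"
      unfolding R_def by (intro continuous_intros)
    then obtain z where z: "L i \<le> z" "z \<le> U i" "(-1) ^ i * R z = 0"
      using IVT'[of "\<lambda>y. (-1) ^ i * R y" "L i" 0 "U i"] signL[OF i] signU[OF i] LU[OF i]
      by auto
    then have "R z = 0" by simp
    moreover have "z \<noteq> L i" "z \<noteq> U i" using signL[OF i] signU[OF i] \<open>R z = 0\<close> by auto
    ultimately show ?thesis using z by force
  qed
  then obtain z where z: "\<And>i. i \<le> M \<Longrightarrow> L i < z i \<and> z i < U i \<and> R (z i) = 0" by metis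
  have U0: "U i \<le> 0" if "i \<le> M" for i
  proof (cases i)
    case (Suc k)
    then show ?thesis using pos[of k] q that by (simp add: U_def)
  qed (simp add: U_def)
  show ?thesis
  proof (rule that)
    show "R (z i) = 0" "z i < 0" if "i \<le> M" for i using z[OF that] U0[OF that] by auto
    show "z (Suc i) < z i / q" if "i < M" for i
    proof -
      \<comment> \<open>The right end of gap \<open>Suc i\<close> is exactly \<open>L i / q\<close>,
        so separation of the new zeros is built into the gaps.\<close>
      have "z (Suc i) < L i / q" using z[of "Suc i"] that by (simp add: U_def L_def mult.commute)
      also have "\<dots> < z i / q" using z[of i] that q by (simp add: divide_strict_right_mono)
      finally show ?thesis .
    qed
  qed
qed

lemma defexp_poly_factorization:
  assumes q: "0 < q" "q < 1"
  shows "\<exists>c. (\<forall>i<N. 0 < c i) \<and> (\<forall>i. Suc i < N \<longrightarrow> c (Suc i) < q * c i) \<and>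
             (\<forall>y. poly (defexp_poly q N) y = (\<Prod>i<N. 1 + c i * y))"
proof (induction N)
  case 0
  then show ?case by (simp add: poly_defexp_poly)
next
  case (Suc N)
  then obtain c where c: "\<And>i. i < N \<Longrightarrow> 0 < c i" "\<And>i. Suc i < N \<Longrightarrow> c (Suc i) < q * c i"
    and P: "\<And>y. poly (defexp_poly q N) y = (\<Prod>i<N. 1 + c i * y)" by blast
  obtain z where
    z: "\<And>i. i \<le> N \<Longrightarrow> (\<Prod>k<N. 1 + c k * z i) + z i * (\<Prod>k<N. 1 + c k * (q * z i)) = 0"
    and neg: "\<And>i. i \<le> N \<Longrightarrow> z i < 0" and zq: "\<And>i. i < N \<Longrightarrow> z (Suc i) < z i / q"
    using q_separated_zeros_step[where c = c and M = N, OF q c] by blast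
  have less: "z (Suc i) < z i" if "i < N" for i
  proof -
    have "z i / q < z i" using q neg[of i] that by (simp add: field_simps)
    then show ?thesis using zq[OF that] by linarith
  qed
  have mono: "z j < z i" if "i < j" "j \<le> N" for i j
    using that
  proof (induction j)
    case (Suc j)
    then show ?case using less[of j] by (cases "i = j") auto
  qed auto
  have inj: "inj_on z {..<Suc N}"
    by (rule linorder_inj_onI) (use mono in \<open>auto simp: less_Suc_eq_le\<close>, force)
  \<comment> \<open>The \<open>N + 1\<close> distinct zeros found exhaust the degree, so no other
    zeros, real or complex, remain.\<close>
  have prod: "poly (defexp_poly q (Suc N)) y = (\<Prod>i<Suc N. 1 - y / z i)" for y
  proof (rule poly_eq_prod_roots[OF degree_defexp_poly poly_defexp_poly_0 inj])
    show "z i \<noteq> 0" "poly (defexp_poly q (Suc N)) (z i) = 0" if "i < Suc N" for i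
      using neg[of i] z[of i] that by (auto simp: poly_defexp_poly_Suc P)
  qed
  show ?case
  proof (intro exI[of _ "\<lambda>i. - 1 / z i"] conjI allI impI)
    show "0 < - 1 / z i" if "i < Suc N" for i using neg[of i] that by (simp add: divide_neg_neg)
    show "- 1 / z (Suc i) < q * (- 1 / z i)" if "Suc i < Suc N" for i
      using neg[of i] neg[of "Suc i"] zq[of i] that q by (simp add: field_simps)
    show "poly (defexp_poly q (Suc N)) y = (\<Prod>i<Suc N. 1 + - 1 / z i * y)" for y
      unfolding prod by (intro prod.cong) auto
  qed
qed

section \<open>The deformed exponential function\<close>

text \<open>Parameter and argument may move together, as the mean value argument for the derivative
  of a zero requires. Since \<open>\<bar>t n\<bar> \<le> 1\<close>, the exponential series at
  \<open>\<bar>Y\<bar> + 1\<close> is a majorant.\<close>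

lemma tendsto_defexp:
  assumes t: "(t \<longlongrightarrow> q) F" and y: "(y \<longlongrightarrow> Y) F" and le: "\<forall>\<^sub>F n in F. \<bar>t n\<bar> \<le> 1" and F: "F \<noteq> bot"
  shows "((\<lambda>n. defexp (t n) (y n)) \<longlongrightarrow> defexp q Y) F"
  unfolding defexp_def
proof (rule tannery_dominated[where M = "\<lambda>k. (\<bar>Y\<bar> + 1) ^ k / fact k"])
  show "((\<lambda>n. y n ^ k * t n ^ (k * (k - 1) div 2) / fact k)
      \<longlongrightarrow> Y ^ k * q ^ (k * (k - 1) div 2) / fact k) F" for k
    by (intro tendsto_intros t y) simp
  have "\<forall>\<^sub>F n in F. \<bar>y n\<bar> < \<bar>Y\<bar> + 1"
    by (rule order_tendstoD[OF tendsto_rabs[OF y]]) simp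
  with le show "\<forall>\<^sub>F n in F. \<forall>k. \<bar>y n ^ k * t n ^ (k * (k - 1) div 2) / fact k\<bar> \<le> (\<bar>Y\<bar> + 1) ^ k / fact k"
  proof eventually_elim
    case (elim n)
    show ?case
    proof
      fix k
      have "\<bar>y n\<bar> ^ k * \<bar>t n\<bar> ^ (k * (k - 1) div 2) \<le> (\<bar>Y\<bar> + 1) ^ k * 1"
        using elim by (intro mult_mono power_mono power_le_one) auto
      then show "\<bar>y n ^ k * t n ^ (k * (k - 1) div 2) / fact k\<bar> \<le> (\<bar>Y\<bar> + 1) ^ k / fact k"
        by (simp add: abs_mult power_abs divide_right_mono)
    qed
  qed
  show "summable (\<lambda>k. (\<bar>Y\<bar> + 1) ^ k / fact k)"
    using summable_exp[of "\<bar>Y\<bar> + 1"] by (simp add: field_simps)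
qed (use F in auto)

lemma summable_defexp:
  fixes q x :: real
  assumes "\<bar>q\<bar> \<le> 1"
  shows "summable (\<lambda>n. x ^ n * q ^ (n * (n - 1) div 2) / fact n)"
proof (rule summable_comparison_test)
  show "summable (\<lambda>n. \<bar>x\<bar> ^ n / fact n)"
    using summable_exp[of "\<bar>x\<bar>"] by (simp add: field_simps)
  have "\<bar>x\<bar> ^ n * \<bar>q\<bar> ^ (n * (n - 1) div 2) \<le> \<bar>x\<bar> ^ n * 1" for n
    using assms by (intro mult_mono power_le_one) auto
  then show "\<exists>N. \<forall>n\<ge>N. norm (x ^ n * q ^ (n * (n - 1) div 2) / fact n) \<le> \<bar>x\<bar> ^ n / fact n"
    by (simp add: abs_mult power_abs divide_right_mono)
qed

text \<open>Lowering the index by one removes \<open>n\<close> from the exponent of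
  \<open>q\<close>, so the differentiated term is the original term at \<open>q * x\<close>.\<close>

lemma DERIV_defexp:
  assumes "\<bar>q\<bar> \<le> 1"
  shows "(defexp q has_real_derivative defexp q (q * x)) (at x)"
proof -
  define c where "c n = q ^ (n * (n - 1) div 2) / fact n" for n
  have "((\<lambda>x. \<Sum>n. c n * x ^ n) has_real_derivative (\<Sum>n. diffs c n * x ^ n)) (at x)"
    using summable_defexp[OF assms]
    by (intro termdiffs_strong_converges_everywhere) (simp add: c_def mult.commute)
  moreover have "(\<lambda>x. \<Sum>n. c n * x ^ n) = defexp q"
    by (simp add: defexp_def c_def mult.commute fun_eq_iff)
  moreover have "diffs c n * x ^ n = (q * x) ^ n * q ^ (n * (n - 1) div 2) / fact n" for n
    unfolding diffs_def c_def triangle_Suc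
    by (simp add: power_add power_mult_distrib field_simps del: of_nat_Suc)
  ultimately show ?thesis by (simp add: defexp_def)
qed

text \<open>Termwise, the factor \<open>n(n-1)/2\<close> cancels against \<open>fact n\<close> to
  leave \<open>1 / (2 * fact (n - 2))\<close>. After a shift by 2 the exponent is
  \<open>e n + 2 * n\<close>, which accounts for the argument \<open>q\<^sup>2 * x\<close>.\<close>

lemma DERIV_defexp_parameter:
  assumes q: "0 < q" "q < 1"
  shows "((\<lambda>t. defexp t x) has_real_derivative x\<^sup>2 / 2 * defexp q (q\<^sup>2 * x)) (at q)"
proof -
  define e where "e n = n * (n - 1) div 2" for n :: nat
  define d where "d n t = x ^ n * (real (e n) * t ^ (e n - 1)) / fact n" for n t
  have dle: "norm (d n t) \<le> (2 * \<bar>x\<bar>) ^ n / fact n" if "t \<in> {0..1}" for n t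
  proof -
    \<comment> \<open>\<open>e n\<close> is \<open>n choose 2\<close>; this crude bound keeps the
      majorant an exponential series, at \<open>2 * \<bar>x\<bar>\<close>.\<close>
    have "e n \<le> 2 ^ n" using binomial_le_pow2[of n 2] by (simp add: e_def choose_two)
    then have "real (e n) \<le> 2 ^ n" by (metis of_nat_le_iff of_nat_numeral of_nat_power)
    then have "real (e n) * \<bar>t\<bar> ^ (e n - 1) \<le> 2 ^ n * 1"
      using that by (intro mult_mono power_le_one) auto
    then have "\<bar>x\<bar> ^ n * (real (e n) * \<bar>t\<bar> ^ (e n - 1)) \<le> \<bar>x\<bar> ^ n * 2 ^ n"
      by (intro mult_left_mono) auto
    then show ?thesis
      by (simp add: d_def abs_mult power_abs power_mult_distrib divide_right_mono mult.commute)
  qed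
  have sm: "summable (\<lambda>n. (2 * \<bar>x\<bar>) ^ n / fact n)"
    using summable_exp[of "2 * \<bar>x\<bar>"] by (simp add: field_simps)
  have "((\<lambda>t. \<Sum>n. x ^ n * t ^ e n / fact n) has_real_derivative (\<Sum>n. d n q)) (at q)"
  proof (rule has_field_derivative_series'(2))
    show "((\<lambda>t. x ^ n * t ^ e n / fact n) has_real_derivative d n t) (at t within {0..1})" for n t
      unfolding d_def by (auto intro!: derivative_eq_intros)
    show "uniformly_convergent_on {0..1} (\<lambda>n t. \<Sum>i<n. d i t)"
      by (rule Weierstrass_m_test'[OF _ sm]) (use dle in auto)
    show "summable (\<lambda>n. x ^ n * q ^ e n / fact n)"
      using summable_defexp[of q x] q by (simp add: e_def)
  qed (use q in auto)
  moreover have "(\<Sum>n. d n q) = x\<^sup>2 / 2 * defexp q (q\<^sup>2 * x)"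
  proof -
    have "summable (\<lambda>n. d n q)"
      by (rule summable_comparison_test[OF _ sm]) (use dle q in auto)
    then have "(\<Sum>n. d n q) = (\<Sum>n. d (n + 2) q) + (\<Sum>n<2. d n q)"
      by (rule suminf_split_initial_segment)
    also have "(\<Sum>n<2. d n q) = 0" by (simp add: d_def e_def numeral_2_eq_2)
    also have "(\<lambda>n. d (n + 2) q)
        = (\<lambda>n. x\<^sup>2 / 2 * ((q\<^sup>2 * x) ^ n * q ^ (n * (n - 1) div 2) / fact n))"
    proof
      fix n
      have e: "e (n + 2) - 1 = e n + 2 * n"
        using triangle_Suc[of n] triangle_Suc[of "Suc n"] by (simp add: e_def)
      have "even ((n + 2) * (n + 2 - 1))" by simp
      then have "2 * e (n + 2) = (n + 2) * (n + 2 - 1)"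
        unfolding e_def by (rule dvd_mult_div_cancel)
      then have "2 * e (n + 2) = (n + 2) * (n + 1)" by simp
      then have "real (2 * e (n + 2)) = real ((n + 2) * (n + 1))" by (simp only:)
      then have e2: "real (e (n + 2)) = (real n + 2) * (real n + 1) / 2"
        by (simp only: of_nat_mult of_nat_add of_nat_1 of_nat_numeral)
      have f: "fact (n + 2) = (real n + 2) * (real n + 1) * fact n"
        by (simp add: algebra_simps)
      have "d (n + 2) q = x ^ (n + 2) * ((real n + 2) * (real n + 1) / 2 * q ^ (e n + 2 * n))
          / ((real n + 2) * (real n + 1) * fact n)"
        unfolding d_def e e2 f ..
      also have "\<dots> = x ^ (n + 2) * q ^ (e n + 2 * n) / (2 * fact n)"
        by (simp add: divide_simps)
      also have "\<dots> = x\<^sup>2 / 2 * ((q\<^sup>2 * x) ^ n * q ^ e n / fact n)"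
        by (simp add: power_add power_mult power_mult_distrib power2_eq_square)
      finally show "d (n + 2) q = x\<^sup>2 / 2 * ((q\<^sup>2 * x) ^ n * q ^ (n * (n - 1) div 2) / fact n)"
        by (simp add: e_def)
    qed
    also have "suminf \<dots> = x\<^sup>2 / 2 * defexp q (q\<^sup>2 * x)"
      unfolding defexp_def
      by (rule suminf_mult, rule summable_defexp) (use q in auto)
    finally show ?thesis by simp
  qed
  ultimately show ?thesis by (simp add: defexp_def e_def)
qed

section \<open>Passage from the polynomials to the product representation\<close>

lemma binomial_over_power_tendsto: "(\<lambda>N. real (N choose n) / real N ^ n) \<longlonglongrightarrow> 1 / fact n"
proof -
  have "(\<lambda>N. (\<Prod>i=0..<n. (real N - real i) / real N) / fact n) \<longlonglongrightarrow> (\<Prod>i=0..<n. 1) / fact n"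
    by (intro tendsto_intros) (simp_all, real_asymp)
  moreover have "(\<Prod>i=0..<n. (real N - real i) / real N) / fact n = real (N choose n) / real N ^ n" for N
    by (simp add: binomial_gbinomial gbinomial_prod_rev prod_dividef)
  ultimately show ?thesis by simp
qed

lemma defexp_poly_tendsto_defexp:
  assumes q: "0 < q" "q < 1"
  shows "(\<lambda>N. poly (defexp_poly q N) (x / real N)) \<longlonglongrightarrow> defexp q x"
proof -
  define a where "a n N = x ^ n * q ^ (n * (n - 1) div 2) * (real (N choose n) / real N ^ n)" for n N
  have "(\<lambda>N. \<Sum>n. a n N) \<longlonglongrightarrow> (\<Sum>n. x ^ n * q ^ (n * (n - 1) div 2) * (1 / fact n))"
  proof (rule tannery_dominated[where M = "\<lambda>n. \<bar>x\<bar> ^ n / fact n"])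
    show "(\<lambda>N. a n N) \<longlonglongrightarrow> x ^ n * q ^ (n * (n - 1) div 2) * (1 / fact n)" for n
      unfolding a_def by (intro tendsto_intros binomial_over_power_tendsto)
    have "\<bar>a n N\<bar> \<le> \<bar>x\<bar> ^ n / fact n" for n N
    proof -
      have "real ((N choose n) * fact n) \<le> real (N ^ n)"
        using binomial_fact_pow[of N n] by (simp only: of_nat_le_iff)
      \<comment> \<open>For \<open>N = 0\<close> and \<open>n > 0\<close> the quotient is 0/0, which
        is 0 by convention.\<close>
      then have "real (N choose n) / real N ^ n \<le> 1 / fact n"
        by (cases "N = 0 \<and> n > 0") (auto simp: divide_simps)
      then have "\<bar>x\<bar> ^ n * q ^ (n * (n - 1) div 2) * (real (N choose n) / real N ^ n)
          \<le> \<bar>x\<bar> ^ n * 1 * (1 / fact n)"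
        using q by (intro mult_mono power_le_one) auto
      then show ?thesis using q by (simp add: a_def abs_mult power_abs)
    qed
    then show "\<forall>\<^sub>F N in sequentially. \<forall>n. \<bar>a n N\<bar> \<le> \<bar>x\<bar> ^ n / fact n" by simp
    show "summable (\<lambda>n. \<bar>x\<bar> ^ n / fact n)"
      using summable_exp[of "\<bar>x\<bar>"] by (simp add: field_simps)
  qed auto
  moreover have "(\<Sum>n. a n N) = poly (defexp_poly q N) (x / real N)" for N
  proof -
    have "(\<Sum>n. a n N) = (\<Sum>n\<le>N. a n N)"
      by (rule suminf_finite) (auto simp: a_def)
    then show ?thesis by (simp add: poly_defexp_poly a_def power_divide mult_ac)
  qed
  ultimately show ?thesis by (simp add: defexp_def)
qed

lemma defexp_product_representation:
  assumes q: "0 < q" "q < 1"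
  obtains b where "geo_decay q b" "\<And>y. defexp q y = (\<Prod>j. 1 + b j * y)"
proof -
  obtain c where c: "\<And>N i. i < N \<Longrightarrow> 0 < c N i" "\<And>N i. Suc i < N \<Longrightarrow> c N (Suc i) < q * c N i"
    and P: "\<And>N y. poly (defexp_poly q N) y = (\<Prod>i<N. 1 + c N i * y)"
    using defexp_poly_factorization[OF q] by metis
  \<comment> \<open>Dividing by \<open>N\<close> moves the substitution \<open>y / N\<close> into
    the coefficients; the padding with 0 turns the finite products into infinite ones without
    breaking the decay.\<close>
  define d where "d N i = (if i < N then c N i / real N else 0)" for N i
  have geo: "geo_decay q (d N)" for N
    unfolding geo_decay_def
  proof (intro allI conjI)
    fix i
    show "0 \<le> d N i" using c(1)[of i N] by (auto simp: d_def)
    show "d N (Suc i) \<le> q * d N i"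
    proof (cases "Suc i < N")
      case True
      then show ?thesis using c(2)[of i N] by (simp add: d_def divide_right_mono)
    qed (use c(1)[of i N] q in \<open>auto simp: d_def\<close>)
  qed
  have "(\<Prod>j. 1 + d N j * y) = poly (defexp_poly q N) (y / real N)" for N y
  proof -
    have "(\<Prod>j. 1 + d N j * y) = (\<Prod>j<N. 1 + d N j * y)"
      by (rule prodinf_finite) (auto simp: d_def)
    also have "\<dots> = poly (defexp_poly q N) (y / real N)"
      unfolding P by (intro prod.cong) (auto simp: d_def)
    finally show ?thesis .
  qed
  then have "(\<lambda>N. \<Prod>j. 1 + d N j * y) \<longlonglongrightarrow> defexp q y" for y
    using defexp_poly_tendsto_defexp[OF q] by simp
  then show ?thesis
    using geo_decay_product_limit[where c = d and \<rho> = q, OF geo] q that by (metis less_imp_le)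
qed

section \<open>Recovering the coefficients of a product from its zeros\<close>

text \<open>Writing \<open>f\<close> as \<open>g\<close> composed with \<open>h\<close> forces
  \<open>h\<close> to be strictly increasing on the naturals, so \<open>n \<le> h n\<close> and
  \<open>f n \<le> g n\<close>; the roles are then exchanged.\<close>

lemma decreasing_enumeration_unique:
  fixes f g :: "nat \<Rightarrow> real"
  assumes f: "monotone (<) (>) f" and g: "monotone (<) (>) g"
    and range: "range f = range g"
  shows "f = g"
proof -
  have le: "f n \<le> g n" if f: "monotone (<) (>) f" and g: "monotone (<) (>) g"
    and "range f = range g" for f g :: "nat \<Rightarrow> real" and n
  proof -
    have "\<forall>i. \<exists>j. f i = g j" using that(3) by (metis rangeE rangeI)
    then obtain h where h: "\<And>i. f i = g (h i)" by metis
    have "strict_mono h"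
    proof (rule strict_monoI)
      fix i j :: nat assume "i < j"
      then have "g (h j) < g (h i)" using monotoneD[OF f] h by metis
      then show "h i < h j" using monotoneD[OF g] by (metis less_asym linorder_neqE_nat)
    qed
    then have "n \<le> h n" by (rule strict_mono_imp_increasing)
    then show ?thesis unfolding h using monotoneD[OF g, of n "h n"] by (cases "n = h n") auto
  qed
  show ?thesis
    by (intro ext order_antisym le f g range range[symmetric])
qed

text \<open>Compactness only produces some coefficients \<open>b\<close>. Their decay makes
  \<open>- 1 / b j\<close> a strictly decreasing enumeration of the zeros, and there is only one
  such enumeration.\<close>

lemma product_zeros_enumeration:
  fixes X b :: "nat \<Rightarrow> real"
  assumes b: "geo_decay \<rho> b" and \<rho>: "0 < \<rho>" "\<rho> < 1"
    and f: "\<And>y. f y = (\<Prod>j. 1 + b j * y)"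
    and X: "{y. f y = 0} = range X" "monotone (<) (>) X"
  shows "X j < 0" "b j = - 1 / X j"
proof -
  have sb: "summable (\<lambda>j. \<bar>b j * y\<bar>)" for y
    unfolding abs_mult using \<rho> by (intro summable_mult2 geo_decay_summable[OF b]) auto
  have zero_iff: "f y = 0 \<longleftrightarrow> (\<exists>j. 1 + b j * y = 0)" for y
    using has_prod_eq_0_iff[OF convergent_prod_has_prod[OF convergent_prod_one_plus[OF sb[of y]]]]
    by (auto simp: f image_iff)
  have nonneg: "0 \<le> b j" and step: "b (Suc j) \<le> \<rho> * b j" for j
    using b by (auto simp: geo_decay_def)
  have step': "b (Suc j) \<le> b j" for j
    using step[of j] nonneg[of j] \<rho> mult_right_mono[of \<rho> 1 "b j"] by linarith
  have anti: "b j \<le> b i" if "i \<le> j" for i j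
    using that step' by (rule lift_Suc_antimono_le[rotated])
  have zeros: "{y. f y = 0} = (\<lambda>j. - 1 / b j) ` {j. b j \<noteq> 0}"
  proof (intro equalityI subsetI)
    fix y assume "y \<in> {y. f y = 0}"
    then obtain j where "1 + b j * y = 0" using zero_iff by blast
    then have bj: "y * b j = - 1" "b j \<noteq> 0" by (auto simp: mult.commute)
    then have "y = - 1 / b j" by (metis nonzero_eq_divide_eq)
    with bj show "y \<in> (\<lambda>j. - 1 / b j) ` {j. b j \<noteq> 0}" by blast
  next
    fix y assume "y \<in> (\<lambda>j. - 1 / b j) ` {j. b j \<noteq> 0}"
    then show "y \<in> {y. f y = 0}" using zero_iff by auto
  qed
  have "inj X" by (rule linorder_injI) (use monotoneD[OF X(2)] in force)
  then have inf: "infinite {y. f y = 0}" unfolding X(1) by (simp add: finite_image_iff)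
  \<comment> \<open>A vanishing \<open>b m\<close> would force all later ones to vanish and leave
    only finitely many zeros, whereas \<open>X\<close> enumerates infinitely many.\<close>
  have nz: "b m \<noteq> 0" for m
  proof
    assume "b m = 0"
    then have "{j. b j \<noteq> 0} \<subseteq> {..<m}" 
      using anti nonneg by (metis (mono_tags) antisym lessThan_iff mem_Collect_eq not_le_imp_less subsetI)
    then have "finite {j. b j \<noteq> 0}" by (rule finite_subset) auto
    then show False using inf unfolding zeros by simp
  qed
  then have pos: "0 < b m" for m using nonneg[of m] by (simp add: order_less_le)
  have strict: "b j < b i" if "i < j" for i j
    using that
  proof (rule lift_Suc_mono_less[of "\<lambda>j. - b j", simplified, rotated])
    show "b (Suc j) < b j" for j
      using step[of j] pos[of j] \<rho> mult_strict_right_mono[of \<rho> 1 "b j"] by linarith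
  qed
  have "X = (\<lambda>j. - 1 / b j)"
  proof (rule decreasing_enumeration_unique)
    show "monotone (<) (>) (\<lambda>j. - 1 / b j)"
      using strict pos by (intro monotoneI) (simp add: frac_less2)
    show "range X = range (\<lambda>j. - 1 / b j)" using zeros nz by (simp add: X(1))
  qed (rule X(2))
  then show "X j < 0" "b j = - 1 / X j" using pos[of j] by (auto simp: divide_neg_pos)
qed

section \<open>Zeros\<close>

lemma defexp_zeros_product:
  assumes q: "0 < q" "q < 1"
    and X: "{y. defexp q y = 0} = range X" "monotone (<) (>) X"
  shows "X j < 0" "geo_decay q (\<lambda>j. - 1 / X j)" "defexp q y = (\<Prod>j. 1 + - 1 / X j * y)"
proof -
  obtain b where b: "geo_decay q b" "\<And>y. defexp q y = (\<Prod>j. 1 + b j * y)"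
    using defexp_product_representation[OF q] by blast
  note enum = product_zeros_enumeration[OF b(1) q b(2) X]
  show "X j < 0" by (rule enum)
  have "b = (\<lambda>j. - 1 / X j)" by (rule ext) (rule enum(2))
  with b show "geo_decay q (\<lambda>j. - 1 / X j)" "defexp q y = (\<Prod>j. 1 + - 1 / X j * y)" by simp_all
qed

text \<open>\<open>G\<close> is the product with factor \<open>k\<close> replaced by 1.
  Differentiating \<open>(1 - y / X k) * G y\<close> at \<open>X k\<close> and using
  \<open>f'(y) = f(q y)\<close> evaluates \<open>f\<close> at \<open>q * X k\<close>; the value is
  nonzero because the remaining zeros differ from \<open>X k\<close>. In particular the zero is
  simple.\<close>

lemma defexp_split_zero:
  fixes k :: nat
  assumes q: "0 < q" "q < 1"
    and X: "{y. defexp q y = 0} = range X" "monotone (<) (>) X"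
  defines "G \<equiv> \<lambda>y. \<Prod>j. 1 + (if j = k then 0 else - 1 / X j) * y"
  shows "(\<lambda>j. 1 + (if j = k then 0 else - 1 / X j) * y) has_prod G y"
    and "defexp q y = (1 - y / X k) * G y"
    and "defexp q (q * X k) = - G (X k) / X k"
    and "defexp q (q * X k) \<noteq> 0"
proof -
  note P = defexp_zeros_product[OF q X]
  define c where "c j = (if j = k then 0 else - 1 / X j)" for j
  have "summable (\<lambda>j. \<bar>- 1 / X j\<bar>)" using geo_decay_summable[OF P(2)] q by simp
  then have c: "summable (\<lambda>j. \<bar>c j\<bar>)"
    by (rule summable_comparison_test[rotated]) (auto simp: c_def)
  then have "summable (\<lambda>j. \<bar>c j * y\<bar>)" for y
    unfolding abs_mult by (rule summable_mult2)
  then have G: "(\<lambda>j. 1 + c j * y) has_prod G y" for y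
    unfolding G_def c_def[symmetric] by (intro convergent_prod_has_prod convergent_prod_one_plus)
  then show "(\<lambda>j. 1 + (if j = k then 0 else - 1 / X j) * y) has_prod G y" by (simp only: c_def)
  have split: "defexp q y = (1 - y / X k) * G y" for y
  proof -
    have "(\<lambda>j. (if j = k then 1 - y / X j else 1) * (1 + c j * y)) has_prod ((1 - y / X k) * G y)"
      by (rule has_prod_mult[OF has_prod_single G])
    moreover have "(if j = k then 1 - y / X j else 1) * (1 + c j * y) = 1 + - 1 / X j * y" for j
      by (simp add: c_def)
    ultimately have "(\<lambda>j. 1 + - 1 / X j * y) has_prod ((1 - y / X k) * G y)" by simp
    then show ?thesis unfolding P(3) by (rule has_prod_unique[symmetric])
  qed
  then show "defexp q y = (1 - y / X k) * G y" .
  have Xk: "X k < 0" by (rule P(1))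
  have nz: "1 + c j * X k \<noteq> 0" for j
  proof (cases "j = k")
    case False
    then have "X j \<noteq> X k" using monotoneD[OF X(2)] by (metis less_irrefl linorder_neqE_nat)
    then show ?thesis using False P(1)[of j] by (simp add: c_def)
  qed (simp add: c_def)
  have GX: "G (X k) \<noteq> 0" unfolding has_prod_eq_0_iff[OF G] using nz by (auto simp: image_iff)
  have "(G has_real_derivative G (X k) * (\<Sum>j. c j / (1 + c j * X k))) (at (X k))"
    using log_derivative_prodinf_linear(2)[OF c nz] unfolding G_def c_def .
  then have "((\<lambda>y. (1 - y / X k) * G y) has_real_derivative - G (X k) / X k) (at (X k))"
    using Xk by (auto intro!: derivative_eq_intros simp: field_simps)
  moreover have "(\<lambda>y. (1 - y / X k) * G y) = defexp q" using split by auto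
  ultimately have "(defexp q has_real_derivative - G (X k) / X k) (at (X k))" by simp
  then show *: "defexp q (q * X k) = - G (X k) / X k"
    by (rule DERIV_unique[rotated]) (rule DERIV_defexp, use q in auto)
  show "defexp q (q * X k) \<noteq> 0" unfolding * using GX Xk by simp
qed

text \<open>The left side is the logarithmic derivative of the product, the right side is
  \<open>f'(y) / f(y)\<close> with \<open>f'(y) = f(q y)\<close>.\<close>

lemma defexp_log_derivative_sums:
  assumes q: "0 < q" "q < 1"
    and X: "{y. defexp q y = 0} = range X" "monotone (<) (>) X"
    and y: "defexp q y \<noteq> 0"
  shows "(\<lambda>j. 1 / (y - X j)) sums (defexp q (q * y) / defexp q y)"
proof -
  note P = defexp_zeros_product[OF q X]
  define c where "c j = - 1 / X j" for j
  have c: "summable (\<lambda>j. \<bar>c j\<bar>)"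
    unfolding c_def by (rule geo_decay_summable[OF P(2)]) (use q in auto)
  have yX: "y \<noteq> X j" for j using X(1) y by blast
  have nz: "1 + c j * y \<noteq> 0" for j
    using yX[of j] P(1)[of j] by (simp add: c_def)
  have fP: "defexp q = (\<lambda>y. \<Prod>j. 1 + c j * y)" using P(3) by (auto simp: c_def)
  note L = log_derivative_prodinf_linear[OF c nz]
  have "(defexp q has_real_derivative defexp q y * (\<Sum>j. c j / (1 + c j * y))) (at y)"
    using L(2) unfolding fP .
  then have "defexp q (q * y) = defexp q y * (\<Sum>j. c j / (1 + c j * y))"
    by (rule DERIV_unique[rotated]) (rule DERIV_defexp, use q in auto)
  then have "(\<lambda>j. c j / (1 + c j * y)) sums (defexp q (q * y) / defexp q y)"
    using L(1) y by (simp add: sums_iff)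
  moreover have "c j / (1 + c j * y) = 1 / (y - X j)" for j
  proof -
    have "c j * (y - X j) = 1 + c j * y" using P(1)[of j] by (simp add: c_def field_simps)
    then show ?thesis using nz[of j] yX[of j] by (simp add: frac_eq_eq)
  qed
  ultimately show ?thesis by simp
qed

section \<open>Dependence of the zeros on the parameter\<close>

text \<open>Otherwise some sequence of parameters tending to \<open>q\<close> keeps the
  \<open>k\<close>-th reciprocal away from its expected limit. Compactness extracts from it a
  product for \<open>defexp q\<close>, whose coefficients are already determined by the zeros: a
  contradiction.\<close>

lemma defexp_zero_tendsto:
  fixes X :: "real \<Rightarrow> nat \<Rightarrow> real"
  assumes X: "\<And>t. 0 < t \<Longrightarrow> t < 1 \<Longrightarrow> {y. defexp t y = 0} = range (X t)"
      "\<And>t. 0 < t \<Longrightarrow> t < 1 \<Longrightarrow> monotone (<) (>) (X t)"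
    and q: "0 < q" "q < 1"
  shows "((\<lambda>t. X t k) \<longlongrightarrow> X q k) (at q)"
proof -
  \<comment> \<open>A decay ratio strictly between \<open>q\<close> and 1 serves all parameters
    below it, hence all those near \<open>q\<close>.\<close>
  define \<rho> where "\<rho> = (1 + q) / 2"
  have \<rho>: "0 < \<rho>" "\<rho> < 1" "q < \<rho>" using q by (auto simp: \<rho>_def)
  have neg: "X t j < 0" if "0 < t" "t < 1" for t j
    by (rule defexp_zeros_product(1)[OF that X(1,2)[OF that]])
  have "((\<lambda>t. - 1 / X t k) \<longlongrightarrow> - 1 / X q k) (at q within {0<..<\<rho>})"
    unfolding tendsto_at_iff_sequentially comp_def
  proof (intro allI impI)
    fix s :: "nat \<Rightarrow> real"
    assume s: "\<forall>i. s i \<in> {0<..<\<rho>} - {q}" and lim: "s \<longlonglongrightarrow> q"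
    have s01: "0 < s n" "s n < 1" "s n < \<rho>" for n using s \<rho> by (auto intro: less_trans)
    show "(\<lambda>n. - 1 / X (s n) k) \<longlonglongrightarrow> - 1 / X q k"
    proof (rule ccontr)
      assume "\<not> (\<lambda>n. - 1 / X (s n) k) \<longlonglongrightarrow> - 1 / X q k"
      then obtain e where e: "e > 0"
        "\<not> (\<forall>\<^sub>F n in sequentially. dist (- 1 / X (s n) k) (- 1 / X q k) < e)"
        unfolding tendsto_iff by blast
      obtain r where r: "strict_mono (r :: nat \<Rightarrow> nat)"
        "\<And>n. \<not> dist (- 1 / X (s (r n)) k) (- 1 / X q k) < e"
        using not_eventually_sequentiallyD[OF e(2)] by blast
      define c where "c n j = - 1 / X (s (r n)) j" for n j
      have geo: "geo_decay \<rho> (c n)" for n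
      proof -
        have "geo_decay (s (r n)) (c n)"
          unfolding c_def by (intro defexp_zeros_product(2) X s01)
        moreover have "s (r n) * c n j \<le> \<rho> * c n j" if "0 \<le> c n j" for j
          using s01(3)[of "r n"] that by (intro mult_right_mono) auto
        ultimately show ?thesis unfolding geo_decay_def by (meson order_trans)
      qed
      have prods: "(\<lambda>n. \<Prod>j. 1 + c n j * y) \<longlonglongrightarrow> defexp q y" for y
      proof -
        have "(\<lambda>n. defexp (s (r n)) y) \<longlonglongrightarrow> defexp q y"
        proof (rule tendsto_defexp)
          show "(\<lambda>n. s (r n)) \<longlonglongrightarrow> q"
            using LIMSEQ_subseq_LIMSEQ[OF lim r(1)] by (simp only: comp_def)
          have "\<bar>s (r n)\<bar> \<le> 1" for n using s01(1,2)[of "r n"] by simp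
          then show "\<forall>\<^sub>F n in sequentially. \<bar>s (r n)\<bar> \<le> 1" by simp
        qed simp_all
        moreover have "defexp (s (r n)) y = (\<Prod>j. 1 + c n j * y)" for n
          unfolding c_def by (intro defexp_zeros_product(3) X s01)
        ultimately show ?thesis by simp
      qed
      obtain r' b where "strict_mono (r' :: nat \<Rightarrow> nat)" and b: "geo_decay \<rho> b"
        "\<And>j. (\<lambda>n. c (r' n) j) \<longlonglongrightarrow> b j" "\<And>y. defexp q y = (\<Prod>j. 1 + b j * y)"
        by (rule geo_decay_product_limit[where c = c and f = "defexp q",
              OF geo less_imp_le[OF \<rho>(1)] \<rho>(2) prods]) (rule that)
      have "b k = - 1 / X q k"
        by (rule product_zeros_enumeration(2)[OF b(1) \<rho>(1,2) b(3) X(1,2)[OF q]])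
      with b(2)[of k] have "\<forall>\<^sub>F n in sequentially. dist (c (r' n) k) (- 1 / X q k) < e"
        using e(1) by (simp add: tendsto_iff)
      then obtain n where "dist (c (r' n) k) (- 1 / X q k) < e"
        by (auto simp: eventually_sequentially)
      then show False using r(2) by (simp add: c_def)
    qed
  qed
  then have "((\<lambda>t. - 1 / X t k) \<longlongrightarrow> - 1 / X q k) (at q)"
    using q \<rho> by (simp add: at_within_open[of q "{0<..<\<rho>}"])
  from tendsto_divide[OF tendsto_const[of "- 1"] this]
  have "((\<lambda>t. - 1 / (- 1 / X t k)) \<longlongrightarrow> - 1 / (- 1 / X q k)) (at q)"
    using neg[OF q, of k] by simp
  then show ?thesis by simp
qed

lemma mvt_between:
  fixes f f' :: "real \<Rightarrow> real"
  assumes "\<And>x. (f has_real_derivative f' x) (at x)"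
  shows "\<exists>\<xi>. \<bar>\<xi> - a\<bar> \<le> \<bar>b - a\<bar> \<and> f b - f a = (b - a) * f' \<xi>"
proof (cases a b rule: linorder_cases)
  case less
  obtain z where "a < z" "z < b" "f b - f a = (b - a) * f' z"
    using MVT2[OF less, of f f'] assms by blast
  then show ?thesis by (intro exI[of _ z]) auto
next
  case greater
  obtain z where "b < z" "z < a" "f a - f b = (a - b) * f' z"
    using MVT2[OF greater, of f f'] assms by blast
  then show ?thesis by (intro exI[of _ z]) (auto simp: algebra_simps)
qed auto

text \<open>Implicit differentiation by hand, from continuity of the zero and the two partial
  derivatives. For fixed \<open>t\<close> the mean value theorem in the argument gives
  \<open>- defexp t Y = (X t k - Y) * defexp t (t * \<xi>)\<close>; dividing by \<open>t - q\<close>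
  and using \<open>defexp q Y = 0\<close> gives the derivative in the limit.\<close>

lemma defexp_zero_has_derivative:
  fixes X :: "real \<Rightarrow> nat \<Rightarrow> real"
  assumes X: "\<And>t. 0 < t \<Longrightarrow> t < 1 \<Longrightarrow> {y. defexp t y = 0} = range (X t)"
      "\<And>t. 0 < t \<Longrightarrow> t < 1 \<Longrightarrow> monotone (<) (>) (X t)"
    and q: "0 < q" "q < 1"
  shows "((\<lambda>t. X t k) has_real_derivative
           - ((X q k)\<^sup>2 / 2 * defexp q (q\<^sup>2 * X q k)) / defexp q (q * X q k)) (at q)"
proof -
  define Y where "Y = X q k"
  have zero: "defexp t (X t k) = 0" if "0 < t" "t < 1" for t
    using X(1)[OF that] by blast
  have "\<forall>t. \<exists>\<xi>. 0 < t \<and> t < 1 \<longrightarrow> \<bar>\<xi> - Y\<bar> \<le> \<bar>X t k - Y\<bar> \<and>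
      defexp t (X t k) - defexp t Y = (X t k - Y) * defexp t (t * \<xi>)"
    using mvt_between[OF DERIV_defexp] by (metis abs_of_pos less_imp_le)
  then obtain \<xi> where \<xi>: "\<And>t. 0 < t \<Longrightarrow> t < 1 \<Longrightarrow> \<bar>\<xi> t - Y\<bar> \<le> \<bar>X t k - Y\<bar>"
    "\<And>t. 0 < t \<Longrightarrow> t < 1 \<Longrightarrow> - defexp t Y = (X t k - Y) * defexp t (t * \<xi> t)"
    using zero by (metis diff_0)
  have near: "\<forall>\<^sub>F t in at q. 0 < t \<and> t < 1"
    using eventually_at_in_open'[of "{0<..<1}" q] q by simp
  have lim: "((\<lambda>t. X t k) \<longlongrightarrow> Y) (at q)"
    unfolding Y_def by (rule defexp_zero_tendsto[OF X q])
  \<comment> \<open>The intermediate point is no farther from \<open>Y\<close> than the zero itself,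
    so it inherits the limit.\<close>
  have "((\<lambda>t. \<xi> t - Y) \<longlongrightarrow> 0) (at q)"
  proof (rule Lim_null_comparison)
    show "\<forall>\<^sub>F t in at q. norm (\<xi> t - Y) \<le> \<bar>X t k - Y\<bar>"
      using near by eventually_elim (use \<xi> in auto)
    show "((\<lambda>t. \<bar>X t k - Y\<bar>) \<longlongrightarrow> 0) (at q)"
      using lim by (simp add: tendsto_rabs_zero_iff LIM_zero_iff)
  qed
  then have "(\<xi> \<longlongrightarrow> Y) (at q)" by (simp add: LIM_zero_iff)
  then have D: "((\<lambda>t. defexp t (t * \<xi> t)) \<longlongrightarrow> defexp q (q * Y)) (at q)"
    using near by (intro tendsto_defexp tendsto_intros) (auto elim: eventually_mono)
  have D0: "defexp q (q * Y) \<noteq> 0"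
    unfolding Y_def by (rule defexp_split_zero(4)[OF q X(1,2)[OF q]])
  have "((\<lambda>t. (defexp t Y - defexp q Y) / (t - q)) \<longlongrightarrow> Y\<^sup>2 / 2 * defexp q (q\<^sup>2 * Y)) (at q)"
    using DERIV_defexp_parameter[OF q] by (simp add: has_field_derivative_iff)
  then have "((\<lambda>t. - ((defexp t Y - defexp q Y) / (t - q)) / defexp t (t * \<xi> t))
      \<longlongrightarrow> - (Y\<^sup>2 / 2 * defexp q (q\<^sup>2 * Y)) / defexp q (q * Y)) (at q)"
    by (intro tendsto_divide tendsto_minus D D0)
  then have "((\<lambda>t. (X t k - Y) / (t - q)) \<longlongrightarrow> - (Y\<^sup>2 / 2 * defexp q (q\<^sup>2 * Y)) / defexp q (q * Y)) (at q)"
  proof (rule Lim_transform_eventually)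
    have "\<forall>\<^sub>F t in at q. defexp t (t * \<xi> t) \<noteq> 0" by (rule tendsto_imp_eventually_ne[OF D D0])
    with near show "\<forall>\<^sub>F t in at q. - ((defexp t Y - defexp q Y) / (t - q)) / defexp t (t * \<xi> t)
        = (X t k - Y) / (t - q)"
    proof eventually_elim
      case (elim t)
      have "defexp q Y = 0" using zero[OF q] by (simp add: Y_def)
      then have "- ((defexp t Y - defexp q Y) / (t - q)) = (X t k - Y) * defexp t (t * \<xi> t) / (t - q)"
        using \<xi>(2)[of t] elim by (metis diff_zero minus_divide_left)
      then show ?case using elim by simp
    qed
  qed
  then show ?thesis by (simp add: has_field_derivative_iff Y_def)
qed

section \<open>The three identities\<close>

theorem theorem2:
  fixes x :: "real \<Rightarrow> nat \<Rightarrow> real"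
  assumes zeros: "\<And>t. 0 < t \<Longrightarrow> t < 1 \<Longrightarrow> {y. defexp t y = 0} = x t ` {1..}"
    and decr: "\<And>t i j. 0 < t \<Longrightarrow> t < 1 \<Longrightarrow> 1 \<le> i \<Longrightarrow> i < j \<Longrightarrow> x t j < x t i"
    and q: "0 < q" "q < 1"
    and k: "1 \<le> k"
  shows "summable (\<lambda>j. 1 / (x q (Suc j) - q * x q k))
       \<and> ((\<lambda>t. x t k) has_real_derivative
            (x q k ^ 2 / 2 * (\<Sum>j. 1 / (x q (Suc j) - q * x q k)))) (at q)
       \<and> (\<lambda>j. 1 / (x q k - q * x q (Suc j))) sums 0
       \<and> (\<lambda>j. if Suc j = k then 1 else (x q (Suc j) - x q k) / (x q (Suc j) - q * x q k))
            has_prod ((q - 1) * x q k)"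
proof -
  \<comment> \<open>The zeros are reindexed from 0, so that \<open>k\<close> corresponds to
    \<open>m = k - 1\<close>.\<close>
  define X where "X t j = x t (Suc j)" for t j
  obtain m where m: "k = Suc m" using k by (cases k) auto
  have X: "{y. defexp t y = 0} = range (X t)" if "0 < t" "t < 1" for t
  proof -
    have "{1..} = range Suc" by (auto simp: image_iff dest: Suc_le_D)
    then show ?thesis using zeros[OF that] by (simp add: X_def image_image)
  qed
  have dec: "monotone (<) (>) (X t)" if "0 < t" "t < 1" for t
    using decr[OF that] by (intro monotoneI) (simp add: X_def)
  note Xq = X[OF q] dec[OF q]
  note split = defexp_split_zero[OF q Xq, where k = m]
  have neg: "X q j < 0" for j by (rule defexp_zeros_product(1)[OF q Xq])

  \<comment> \<open>Logarithmic derivative at \<open>q * X q m\<close>: up to sign it is the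
    quotient occurring in the derivative of the zero.\<close>
  have "(\<lambda>j. - (1 / (q * X q m - X q j)))
      sums - (defexp q (q * (q * X q m)) / defexp q (q * X q m))"
    by (intro sums_minus defexp_log_derivative_sums[OF q Xq split(4)])
  moreover have "- (1 / (q * X q m - X q j)) = 1 / (X q j - q * X q m)" for j
    using minus_divide_right[of 1 "q * X q m - X q j"] by simp
  ultimately have S: "(\<lambda>j. 1 / (X q j - q * X q m))
      sums - (defexp q (q\<^sup>2 * X q m) / defexp q (q * X q m))"
    by (simp add: power2_eq_square mult.assoc)

  have deriv: "((\<lambda>t. X t m) has_real_derivative
      ((X q m)\<^sup>2 / 2 * (\<Sum>j. 1 / (X q j - q * X q m)))) (at q)"
    using defexp_zero_has_derivative[of X q m, OF X dec q] sums_unique[OF S, symmetric] by simp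

  \<comment> \<open>If \<open>X q m / q\<close> were a zero, then \<open>q\<close> times that zero
    would be the zero \<open>X q m\<close>, which \<open>defexp_split_zero\<close> excludes.\<close>
  have "defexp q (X q m / q) \<noteq> 0"
  proof
    assume "defexp q (X q m / q) = 0"
    then obtain i where i: "X q m / q = X q i" using X[OF q] by blast
    have "defexp q (q * X q i) \<noteq> 0" by (rule defexp_split_zero(4)[OF q Xq])
    moreover have "q * X q i = X q m" unfolding i[symmetric] using q by simp
    moreover have "defexp q (X q m) = 0" using X[OF q] by blast
    ultimately show False by simp
  qed
  \<comment> \<open>At \<open>y = X q m / q\<close> the numerator \<open>defexp q (q * y)\<close> is
    the value at a zero, so the sum vanishes.\<close>
  from defexp_log_derivative_sums[OF q Xq this]
  have "(\<lambda>j. 1 / q * (1 / (X q m / q - X q j))) sums (1 / q * (defexp q (X q m) / defexp q (X q m / q)))"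
    using q by (intro sums_mult) simp
  moreover have "defexp q (X q m) = 0" using X[OF q] by blast
  moreover have "1 / q * (1 / (X q m / q - X q j)) = 1 / (X q m - q * X q j)" for j
    using q by (simp add: right_diff_distrib)
  ultimately have zero_sum: "(\<lambda>j. 1 / (X q m - q * X q j)) sums 0" by simp

  let ?c = "\<lambda>j. if j = m then 0 else - 1 / X q j"
  let ?G = "\<lambda>y. \<Prod>j. 1 + ?c j * y"
  have "(\<lambda>j. (1 + ?c j * X q m) * inverse (1 + ?c j * (q * X q m)))
      has_prod (?G (X q m) * inverse (?G (q * X q m)))"
    by (intro has_prod_mult has_prod_inverse split(1))
  moreover have "(1 + ?c j * X q m) * inverse (1 + ?c j * (q * X q m))
      = (if j = m then 1 else (X q j - X q m) / (X q j - q * X q m))" for j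
  proof (cases "j = m")
    case False
    have lin: "1 + ?c j * y = (X q j - y) / X q j" for y
      using neg[of j] False by (simp add: diff_divide_distrib)
    show ?thesis unfolding lin using False neg[of j] by (simp add: inverse_divide)
  qed simp
  \<comment> \<open>Both \<open>?G (X q m)\<close> and \<open>?G (q * X q m)\<close> are multiples
    of \<open>defexp q (q * X q m)\<close>: one through the derivative at the zero, the other
    through the factorization. The common nonzero value cancels in the quotient.\<close>
  moreover have "?G (X q m) * inverse (?G (q * X q m)) = (q - 1) * X q m"
  proof -
    have "?G (X q m) = - X q m * defexp q (q * X q m)"
      using split(3) neg[of m] by simp
    moreover have "defexp q (q * X q m) = (1 - q) * ?G (q * X q m)"
      using split(2)[of "q * X q m"] neg[of m] by simp
    moreover from this have "?G (q * X q m) \<noteq> 0" using split(4) by auto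
    ultimately show ?thesis by (simp add: field_simps)
  qed
  ultimately have prod: "(\<lambda>j. if j = m then 1 else (X q j - X q m) / (X q j - q * X q m))
      has_prod ((q - 1) * X q m)" by simp

  have "(j = m) = (Suc j = k)" for j by (simp add: m)
  with sums_summable[OF S] deriv zero_sum prod show ?thesis
    unfolding X_def m[symmetric] by simp
qed

end
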